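(* Let $Z_n=\sum_{i=0}^{n}Y_i$ for $n\ge 0$, where $Y_0=0$ and, for $n\ge 1$, conditionally on $Y_0,\dots,Y_{n-1}$, $$Y_n\mid Y_0,\dots,Y_{n-1}\ \sim\ \mathrm{Ber}\!\left(\frac{1}{1+\sum_{j=0}^{n-1}Y_j}\right).$$ Then for every $n\ge 0$, $Z_n\stackrel{d}{=}X_n$, where $X_n$ is the random variable with values in $\{0,\dots,n\}$ whose probability distribution is $$P(X_n=k)=\frac{1}{k!}\sum_{i=1}^{k}(-1)^{k-i}\binom{k+1}{i+1}\,i^{k}\left(\frac{i}{i+1}\right)^{n-k},\qquad n\ge k\ge 1,$$ with $P(X_0=0)=1$ and $P(X_n=0)=0$ for $n\ge 1$.
   Context: $\mathrm{Ber}(p)$ denotes the Bernoulli distribution on $\{0,1\}$ with success probability $p$, and $\stackrel{d}{=}$ denotes equality in distribution. *)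

theory Defs
  imports "HOL-Probability.Probability"
begin

text \<open>The law $\mathrm{Ber}(p)$ on $\{0,1\}$; the library's \<open>bernoulli_pmf\<close> lives on \<open>bool\<close>.\<close>

definition Ber :: "real \<Rightarrow> nat pmf" where
  "Ber p = map_pmf of_bool (bernoulli_pmf p)"

definition history :: "'a measure \<Rightarrow> (nat \<Rightarrow> 'a \<Rightarrow> nat) \<Rightarrow> nat \<Rightarrow> (nat \<Rightarrow> nat) \<Rightarrow> 'a set" where
  "history M Y n y = {\<omega> \<in> space M. \<forall>j<n. Y j \<omega> = y j}"

definition X_mass :: "nat \<Rightarrow> nat \<Rightarrow> real" where
  "X_mass n k =
    (if n = 0 \<and> k = 0 then 1
     else if 1 \<le> k \<and> k \<le> n then
       1 / fact k * (\<Sum>i=1..k. (-1) ^ (k - i) * real ((k + 1) choose (i + 1)) * real i ^ k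
                       * (real i / (real i + 1)) ^ (n - k))
     else 0)"

text \<open>\<open>embed_pmf\<close> is meaningful only if \<open>X_mass n\<close> is nonnegative with total mass 1. This is not
  assumed: any statement about \<open>X_law\<close> should come with \<open>pmf (X_law n) k = X_mass n k\<close>.\<close>

definition X_law :: "nat \<Rightarrow> nat pmf" where
  "X_law n = embed_pmf (X_mass n)"

end

theory Submission
  imports Defs
begin

text \<open>Given the history up to time \<open>n\<close>, the law of \<open>Y (n + 1)\<close> depends only on \<open>Z n\<close>, so \<open>Z\<close> is a
  pure birth chain that moves from \<open>j\<close> to \<open>j + 1\<close> with probability \<open>1 / (j + 1)\<close>. The explicit masses
  satisfy the forward equation of this chain: off the diagonal, term by term; on the diagonal, because
  the \<open>(k + 1)\<close>-st finite difference of the polynomial \<open>(t - 1) ^ k\<close> vanishes.\<close>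

text \<open>Splitting one factor \<open>x + of_nat j\<close> off the power leaves two sums of
  exponent \<open>k\<close>. The part with \<open>x\<close> is the induction hypothesis for the same
  \<open>m\<close>; in the part with \<open>j\<close>, absorption turns
  \<open>j * (m choose j)\<close> into \<open>m\<close> times a coefficient of \<open>m - 1\<close>,
  and reindexing shifts \<open>x\<close> to \<open>x + 1\<close>. So both \<open>m\<close> and
  \<open>x\<close> must vary in the induction.\<close>

lemma alternating_choose_power_sum_eq_0:
  fixes x :: "'a::comm_ring_1"
  assumes "k < m"
  shows "(\<Sum>j\<le>m. (-1) ^ j * of_nat (m choose j) * (x + of_nat j) ^ k) = 0"
  using assms
proof (induction k arbitrary: m x)
  case 0
  then show ?case
    using choose_alternating_sum[of m, where ?'a = 'a] by simp
next
  case (Suc k)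
  then obtain l where m: "m = Suc l" and l: "k < l"
    by (cases m) auto
  have "(\<Sum>j\<le>m. (-1) ^ j * of_nat (m choose j) * (x + of_nat j) ^ Suc k)
      = x * (\<Sum>j\<le>m. (-1) ^ j * of_nat (m choose j) * (x + of_nat j) ^ k)
        + (\<Sum>j\<le>m. (-1) ^ j * of_nat (j * (m choose j)) * (x + of_nat j) ^ k)"
    by (simp add: sum_distrib_left sum.distrib[symmetric] algebra_simps)
  also have "(\<Sum>j\<le>m. (-1) ^ j * of_nat (m choose j) * (x + of_nat j) ^ k) = 0"
    using Suc.IH Suc.prems by simp
  also have "(\<Sum>j\<le>m. (-1) ^ j * of_nat (j * (m choose j)) * (x + of_nat j) ^ k)
      = (\<Sum>j\<le>l. (-1) ^ Suc j * of_nat (Suc j * (Suc l choose Suc j)) * (x + of_nat (Suc j)) ^ k)"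
    unfolding m by (subst sum.atMost_Suc_shift) simp
  also have "\<dots> = - of_nat (Suc l) * (\<Sum>j\<le>l. (-1) ^ j * of_nat (l choose j) * ((x + 1) + of_nat j) ^ k)"
    unfolding sum_distrib_left
    by (intro sum.cong refl)
      (simp only: Suc_times_binomial of_nat_mult of_nat_Suc power_Suc mult_ac add_ac mult_minus_left
        mult_minus_right mult_1_left)
  also have "(\<Sum>j\<le>l. (-1) ^ j * of_nat (l choose j) * ((x + 1) + of_nat j) ^ k) = 0"
    using Suc.IH l by blast
  finally show ?case
    by simp
qed

lemma X_mass_diagonal: "X_mass n n = 1 / fact n"
proof (cases "n = 0")
  case False
  have pm: "(-1::real) ^ (n - i) = - ((-1) ^ n * (-1) ^ Suc i)" if "i \<le> n" for i
    using that by (auto simp: uminus_power_if)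
  \<comment> \<open>The shift by -1 makes \<open>j = Suc i\<close> contribute \<open>i ^ n\<close>,
    as in \<open>X_mass\<close>, while \<open>j = 0\<close> contributes
    \<open>(-1) ^ n\<close>.\<close>
  have "0 = (\<Sum>j\<le>Suc n. (-1) ^ j * real (Suc n choose j) * (-1 + real j) ^ n)"
    using alternating_choose_power_sum_eq_0[of n "Suc n" "-1::real"] by simp
  also have "\<dots> = (-1) ^ n + (\<Sum>i\<le>n. (-1) ^ Suc i * real (Suc n choose Suc i) * real i ^ n)"
    by (subst sum.atMost_Suc_shift) simp
  \<comment> \<open>The term \<open>i = 0\<close> may be dropped because \<open>0 ^ n = 0\<close>,
    which fails for \<open>n = 0\<close>; hence the case split.\<close>
  also have "(\<Sum>i\<le>n. (-1) ^ Suc i * real (Suc n choose Suc i) * real i ^ n)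
      = (\<Sum>i=1..n. (-1) ^ Suc i * real (Suc n choose Suc i) * real i ^ n)"
    using False by (intro sum.mono_neutral_right) (auto simp: not_le)
  finally have *: "(\<Sum>i=1..n. (-1) ^ Suc i * real (Suc n choose Suc i) * real i ^ n) = - ((-1) ^ n)"
    by linarith
  have "(\<Sum>i=1..n. (-1) ^ (n - i) * real ((n + 1) choose (i + 1)) * real i ^ n)
      = - ((-1) ^ n) * (\<Sum>i=1..n. (-1) ^ Suc i * real (Suc n choose Suc i) * real i ^ n)"
    unfolding sum_distrib_left by (intro sum.cong refl) (subst pm, auto)
  also have "\<dots> = 1"
    unfolding * by (simp flip: power_add mult_2)
  finally show ?thesis
    using False by (simp add: X_mass_def)
qed (simp add: X_mass_def)

lemma X_mass_eq_0: "n < k \<Longrightarrow> X_mass n k = 0"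
  by (auto simp: X_mass_def)

lemma X_mass_Suc_0: "X_mass (Suc n) 0 = 0"
  by (simp add: X_mass_def)

text \<open>The two summands stand for staying at \<open>Suc k\<close> and for jumping there from
  \<open>k\<close>. Since masses outside the range are 0, the equation holds for all
  \<open>n\<close> and \<open>k\<close>.\<close>

lemma X_mass_Suc_Suc:
  "X_mass (Suc n) (Suc k)
    = X_mass n (Suc k) * (real (Suc k) / real (Suc (Suc k))) + X_mass n k / real (Suc k)"
proof -
  consider "n < k" | "n = k" | "n > k" by linarith
  then show ?thesis
  proof cases
    case 1
    then show ?thesis by (simp add: X_mass_eq_0)
  next
    case 2
    then show ?thesis by (simp add: X_mass_diagonal X_mass_eq_0)
  next
    case 3
    define r where "r i = real i / (real i + 1)" for i
    define d where "d = n - Suc k"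
    have d: "Suc n - Suc k = Suc d" "n - k = Suc d" "n - Suc k = d"
      using 3 by (auto simp: d_def)
    \<comment> \<open>For \<open>k = 0\<close> the sum is empty and the mass is 0 because
      \<open>n > 0\<close>, so the formula covers this case too.\<close>
    have X: "X_mass n k
        = 1 / fact k * (\<Sum>i=1..k. (-1) ^ (k - i) * real ((k + 1) choose (i + 1)) * real i ^ k * r i ^ Suc d)"
      using 3 by (cases "k = 0") (auto simp: X_mass_def r_def d)
    \<comment> \<open>The probability of staying at \<open>Suc k\<close>; it coincides with
      \<open>r (Suc k)\<close>.\<close>
    define c where "c = real (Suc k) / real (Suc (Suc k))"
    \<comment> \<open>The sign flip turns \<open>r i - c\<close> into \<open>c - r i\<close>, whose
      numerator \<open>Suc k - i\<close> is absorbed by the binomial coefficient and whose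
      denominator \<open>i + 1\<close> cancels against one factor
      \<open>i = r i * (i + 1)\<close>.\<close>
    have summand: "(-1) ^ (Suc k - i) * real (Suc (Suc k) choose Suc i) * real i ^ Suc k * r i ^ d * (r i - c)
        = (-1) ^ (k - i) * real (Suc k choose Suc i) * real i ^ k * r i ^ Suc d" if "i \<le> k" for i
    proof -
      have "Suc (Suc k) * (Suc k choose Suc i) = (Suc (Suc k) choose Suc i) * (Suc k - i)"
        using binomial_absorb_comp[of "Suc (Suc k)" "Suc i"] by (simp add: mult.commute)
      then have "real (Suc (Suc k)) * real (Suc k choose Suc i)
          = real (Suc (Suc k) choose Suc i) * (real (Suc k) - real i)"
        using that by (metis of_nat_mult of_nat_diff le_SucI)
      then have choose: "real (Suc k choose Suc i)
          = real (Suc (Suc k) choose Suc i) * ((real (Suc k) - real i) / real (Suc (Suc k)))"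
        by (simp add: field_simps del: binomial_Suc_Suc)
      have sign: "(-1::real) ^ (Suc k - i) = - ((-1) ^ (k - i))"
        using that by (simp add: Suc_diff_le)
      have i: "real i ^ Suc k = real i ^ k * (r i * (real i + 1))"
        by (simp add: r_def)
      have diff: "(real (Suc k) - real i) / real (Suc (Suc k)) = (real i + 1) * (c - r i)"
        by (simp add: r_def c_def divide_simps) (simp add: algebra_simps)
      show ?thesis
        unfolding choose sign i diff by (simp add: algebra_simps del: binomial_Suc_Suc)
    qed
    define t where "t i = (-1) ^ (Suc k - i) * real (Suc (Suc k) choose Suc i) * real i ^ Suc k * r i ^ d" for i
    have "X_mass (Suc n) (Suc k) - X_mass n (Suc k) * c
        = 1 / fact (Suc k) * (\<Sum>i=1..Suc k. t i * r i) - 1 / fact (Suc k) * (\<Sum>i=1..Suc k. t i) * c"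
      using 3 by (simp add: X_mass_def t_def r_def d mult_ac add_ac
        del: binomial_Suc_Suc sum.cl_ivl_Suc fact_Suc)
    also have "\<dots> = 1 / fact (Suc k) * (\<Sum>i=1..Suc k. t i * (r i - c))"
      by (simp only: right_diff_distrib sum_subtractf sum_distrib_right mult.assoc)
    \<comment> \<open>The top term vanishes because \<open>r (Suc k) = c\<close>.\<close>
    also have "(\<Sum>i=1..Suc k. t i * (r i - c)) = (\<Sum>i=1..k. t i * (r i - c))"
      by (simp add: r_def c_def add_ac)
    also have "\<dots> = (\<Sum>i=1..k. (-1) ^ (k - i) * real ((k + 1) choose (i + 1)) * real i ^ k * r i ^ Suc d)"
      unfolding t_def by (intro sum.cong refl) (simp only: summand atLeastAtMost_iff Suc_eq_plus1[symmetric])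
    also have "1 / fact (Suc k) * \<dots> = X_mass n k / real (Suc k)"
      unfolding X by (simp add: divide_simps)
    finally show ?thesis
      unfolding c_def by linarith
  qed
qed

lemma pmf_Ber:
  assumes "0 \<le> p" "p \<le> 1"
  shows "pmf (Ber p) b = (if b = 0 then 1 - p else if b = 1 then p else 0)"
proof -
  have inj: "inj (of_bool :: bool \<Rightarrow> nat)"
    by (auto simp: inj_def)
  show ?thesis
    using assms pmf_map_inj'[OF inj, of "bernoulli_pmf p" False]
      pmf_map_inj'[OF inj, of "bernoulli_pmf p" True]
    by (auto simp: Ber_def pmf_eq_0_set_pmf split: if_splits)
qed

context prob_space
begin

context
  fixes Y :: "nat \<Rightarrow> 'a \<Rightarrow> nat" and q :: "nat \<Rightarrow> nat pmf"
  assumes Y[measurable]: "\<And>n. Y n \<in> measurable M (count_space UNIV)"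
    and step: "\<And>n y. n \<ge> 1 \<Longrightarrow> measure M (history M Y n y) > 0 \<Longrightarrow>
      distr (uniform_measure M (history M Y n y)) (count_space UNIV) (Y n) = measure_pmf (q (\<Sum>j<n. y j))"
begin

lemma sets_history[measurable]: "history M Y n y \<in> sets M"
  unfolding history_def by measurable

text \<open>The product rule extends the conditional law in \<open>step\<close> to null histories,
  where both sides are 0.\<close>

lemma prob_history_next:
  assumes "n \<ge> 1"
  shows "prob (history M Y n y \<inter> {\<omega> \<in> space M. Y n \<omega> = b})
    = prob (history M Y n y) * pmf (q (\<Sum>j<n. y j)) b"
proof (cases "prob (history M Y n y) > 0")
  case True
  let ?U = "uniform_measure M (history M Y n y)"
  have "pmf (q (\<Sum>j<n. y j)) b = measure (distr ?U (count_space UNIV) (Y n)) {b}"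
    unfolding step[OF assms True] by (simp add: measure_pmf_single)
  also have "\<dots> = measure ?U {\<omega> \<in> space M. Y n \<omega> = b}"
    by (subst measure_distr) (auto intro!: arg_cong2[where f = measure])
  also have "\<dots> = prob (history M Y n y \<inter> {\<omega> \<in> space M. Y n \<omega> = b}) / prob (history M Y n y)"
    by (rule measure_uniform_measure) (use True in \<open>auto simp: emeasure_eq_measure\<close>)
  finally show ?thesis
    using True by simp
next
  case False
  then have 0: "prob (history M Y n y) = 0"
    by (simp add: zero_less_measure_iff)
  have "prob (history M Y n y \<inter> {\<omega> \<in> space M. Y n \<omega> = b}) \<le> prob (history M Y n y)"
    by (intro finite_measure_mono) auto
  then show ?thesis
    using 0 by (simp add: measure_le_0_iff)
qed

text \<open>Only finitely many histories have a prescribed sum \<open>k\<close>, since all their entries are at most \<open>k\<close>.\<close>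

lemma prob_sum_next:
  assumes "n \<ge> 1"
  shows "prob {\<omega> \<in> space M. (\<Sum>i<n. Y i \<omega>) = k \<and> Y n \<omega> = b}
    = prob {\<omega> \<in> space M. (\<Sum>i<n. Y i \<omega>) = k} * pmf (q k) b"
proof -
  \<comment> \<open>A history only sees the values below \<open>n\<close>. Extensional functions
    represent each history once, which makes the events disjoint.\<close>
  define A where "A = {y \<in> {..<n} \<rightarrow>\<^sub>E {..k}. (\<Sum>i<n. y i) = k}"
  have fin: "finite A"
    unfolding A_def by (intro finite_subset[OF _ finite_PiE[of "{..<n}" "\<lambda>_. {..k}"]]) auto
  have disj: "disjoint_family_on (history M Y n) A"
    unfolding disjoint_family_on_def
  proof (intro ballI impI equals0I)
    fix y z \<omega> assume yz: "y \<in> A" "z \<in> A" "y \<noteq> z" and "\<omega> \<in> history M Y n y \<inter> history M Y n z"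
    then have "y i = z i" if "i \<in> {..<n}" for i
      using that by (auto simp: history_def)
    then have "y = z"
      using yz(1,2) by (intro PiE_ext[of y "{..<n}" _ z]) (auto simp: A_def)
    with yz(3) show False by contradiction
  qed
  have eq: "{\<omega> \<in> space M. (\<Sum>i<n. Y i \<omega>) = k} = (\<Union>y\<in>A. history M Y n y)"
  proof (intro equalityI subsetI)
    fix \<omega> assume "\<omega> \<in> {\<omega> \<in> space M. (\<Sum>i<n. Y i \<omega>) = k}"
    then have "restrict (\<lambda>i. Y i \<omega>) {..<n} \<in> A" "\<omega> \<in> history M Y n (restrict (\<lambda>i. Y i \<omega>) {..<n})"
      by (auto simp: A_def history_def intro!: member_le_sum)
    then show "\<omega> \<in> (\<Union>y\<in>A. history M Y n y)" by blast
  qed (auto simp: A_def history_def)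
  have "{\<omega> \<in> space M. (\<Sum>i<n. Y i \<omega>) = k \<and> Y n \<omega> = b}
      = (\<Union>y\<in>A. history M Y n y \<inter> {\<omega> \<in> space M. Y n \<omega> = b})"
    using eq by auto
  also have "prob \<dots> = (\<Sum>y\<in>A. prob (history M Y n y \<inter> {\<omega> \<in> space M. Y n \<omega> = b}))"
    using fin disj by (intro finite_measure_finite_Union) (auto simp: disjoint_family_on_def)
  \<comment> \<open>Every \<open>y\<close> in \<open>A\<close> has sum \<open>k\<close>, so the
    conditional weight is the same for all of them and factors out.\<close>
  also have "\<dots> = (\<Sum>y\<in>A. prob (history M Y n y) * pmf (q k) b)"
    by (intro sum.cong refl) (simp add: prob_history_next[OF assms] A_def)
  also have "\<dots> = prob (\<Union>y\<in>A. history M Y n y) * pmf (q k) b"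
    using fin disj by (subst finite_measure_finite_Union) (auto simp: sum_distrib_right)
  finally show ?thesis
    unfolding eq .
qed

lemma prob_sum_Suc:
  assumes "n \<ge> 1"
  shows "prob {\<omega> \<in> space M. (\<Sum>i<Suc n. Y i \<omega>) = k}
    = (\<Sum>j\<le>k. prob {\<omega> \<in> space M. (\<Sum>i<n. Y i \<omega>) = j} * pmf (q j) (k - j))"
proof -
  have "{\<omega> \<in> space M. (\<Sum>i<Suc n. Y i \<omega>) = k}
      = (\<Union>j\<le>k. {\<omega> \<in> space M. (\<Sum>i<n. Y i \<omega>) = j \<and> Y n \<omega> = k - j})"
    by auto
  also have "prob \<dots> = (\<Sum>j\<le>k. prob {\<omega> \<in> space M. (\<Sum>i<n. Y i \<omega>) = j \<and> Y n \<omega> = k - j})"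
    by (intro finite_measure_finite_Union) (auto simp: disjoint_family_on_def)
  also have "\<dots> = (\<Sum>j\<le>k. prob {\<omega> \<in> space M. (\<Sum>i<n. Y i \<omega>) = j} * pmf (q j) (k - j))"
    by (simp add: prob_sum_next[OF assms])
  finally show ?thesis .
qed

end

end

text \<open>Nonnegativity and total mass 1 are inherited from \<open>D\<close>. Thus the alternating
  sums in \<open>X_mass\<close> never have to be estimated: it suffices that they are the point
  masses of some probability measure.\<close>

lemma
  fixes D :: "'a::countable measure" and f :: "'a \<Rightarrow> real"
  assumes "prob_space D" "sets D = UNIV" and f: "\<And>x. measure D {x} = f x"
  shows pmf_embed_pmf_measure: "pmf (embed_pmf f) x = f x"
    and measure_pmf_embed_pmf_measure: "measure_pmf (embed_pmf f) = D"
proof -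
  interpret prob_space D by fact
  have nonneg: "0 \<le> f x" for x
    using f[of x] measure_nonneg[of D "{x}"] by simp
  have e: "emeasure D {x} = ennreal (f x)" for x
    by (simp add: emeasure_eq_measure f)
  have total: "(\<integral>\<^sup>+x. ennreal (f x) \<partial>count_space UNIV) = 1"
    using emeasure_countable_singleton[of UNIV D] assms(2) sets_eq_imp_space_eq[of D "count_space UNIV"]
    by (simp add: e[symmetric] emeasure_space_1[symmetric])
  have pmf: "pmf (embed_pmf f) x = f x" for x
    using pmf_embed_pmf[OF nonneg total] .
  then show "pmf (embed_pmf f) x = f x" .
  show "measure_pmf (embed_pmf f) = D"
    by (rule measure_eqI_countable[of _ UNIV]) (auto simp: assms(2) e emeasure_pmf_single pmf)
qed

theorem proposition3:
  fixes M :: "'a measure" and Y Z :: "nat \<Rightarrow> 'a \<Rightarrow> nat"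
  assumes "prob_space M"
    and "\<And>n. Y n \<in> measurable M (count_space UNIV)"
    and "AE \<omega> in M. Y 0 \<omega> = 0"
    and "\<And>n y. n \<ge> 1 \<Longrightarrow> measure M (history M Y n y) > 0 \<Longrightarrow>
           distr (uniform_measure M (history M Y n y)) (count_space UNIV) (Y n)
             = measure_pmf (Ber (1 / (1 + (\<Sum>j=0..n-1. real (y j)))))"
    and "\<And>n \<omega>. Z n \<omega> = (\<Sum>i=0..n. Y i \<omega>)"
  shows "\<forall>n. (\<forall>k. pmf (X_law n) k = X_mass n k)
           \<and> distr M (count_space UNIV) (Z n) = measure_pmf (X_law n)"
proof -
  interpret prob_space M by fact
  note Y[measurable] = assms(2)
  have Z: "Z n \<omega> = (\<Sum>i<Suc n. Y i \<omega>)" for n \<omega>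
    using assms(5) by (simp add: atLeast0AtMost lessThan_Suc_atMost)
  have Z_measurable[measurable]: "Z n \<in> measurable M (count_space UNIV)" for n
    unfolding Z[abs_def] by measurable
  have step: "distr (uniform_measure M (history M Y n y)) (count_space UNIV) (Y n)
      = measure_pmf (Ber (1 / (1 + real (\<Sum>j<n. y j))))"
    if "n \<ge> 1" "measure M (history M Y n y) > 0" for n y
  proof -
    \<comment> \<open>With truncated subtraction this needs \<open>n \<ge> 1\<close>.\<close>
    have "{0..n-1} = {..<n}"
      using that(1) by auto
    then show ?thesis
      using assms(4)[OF that] by simp
  qed
  \<comment> \<open>\<open>Z n\<close> has \<open>n + 1\<close> summands, so
    \<open>prob_sum_Suc\<close> is used at \<open>Suc n\<close> and its side condition holds even
    for \<open>n = 0\<close>.\<close>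
  have rec: "prob {\<omega> \<in> space M. Z (Suc n) \<omega> = k}
      = (\<Sum>j\<le>k. prob {\<omega> \<in> space M. Z n \<omega> = j} * pmf (Ber (1 / (1 + real j))) (k - j))" for n k
    unfolding Z by (rule prob_sum_Suc[OF Y step]) auto
  have prob_Z: "prob {\<omega> \<in> space M. Z n \<omega> = k} = X_mass n k" for n k
  proof (induction n arbitrary: k)
    case 0
    have "prob {\<omega> \<in> space M. Z 0 \<omega> = k} = prob {\<omega> \<in> space M. 0 = k}"
      using assms(3) by (intro measure_eq_AE) (auto simp: Z)
    then show ?case
      by (cases "k = 0") (auto simp: X_mass_def prob_space)
  next
    case (Suc n)
    show ?case
    proof (cases k)
      case 0
      \<comment> \<open>Only \<open>j = 0\<close> contributes, and there the success probability is
        1, so the chain leaves 0 surely.\<close>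
      then show ?thesis
        by (simp add: rec pmf_Ber X_mass_Suc_0)
    next
      case k: (Suc l)
      have "prob {\<omega> \<in> space M. Z (Suc n) \<omega> = k}
          = (\<Sum>j\<le>k. X_mass n j * pmf (Ber (1 / (1 + real j))) (k - j))"
        by (simp add: rec Suc.IH)
      \<comment> \<open>A Bernoulli step gives weight only to \<open>k - j\<close> in {0, 1}, which
        leaves \<open>j = l\<close> and \<open>j = Suc l\<close>.\<close>
      also have "\<dots> = (\<Sum>j\<in>{l, Suc l}. X_mass n j * pmf (Ber (1 / (1 + real j))) (k - j))"
        unfolding k by (intro sum.mono_neutral_right) (auto simp: pmf_Ber)
      also have "\<dots> = X_mass (Suc n) k"
        unfolding k X_mass_Suc_Suc by (simp add: pmf_Ber field_simps)
      finally show ?thesis .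
    qed
  qed
  have "measure (distr M (count_space UNIV) (Z n)) {k} = X_mass n k" for n k
    by (subst measure_distr) (auto simp: prob_Z[symmetric] intro!: arg_cong[where f = prob])
  then show ?thesis
    unfolding X_law_def
    using pmf_embed_pmf_measure measure_pmf_embed_pmf_measure prob_space_distr[OF Z_measurable]
    by (metis sets_distr sets_count_space Pow_UNIV)
qed

end
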